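(* Let $V$ be a discrete valuation ring with valuation $\nu$ and field of fractions $K$, let $n\ge1$, $\mathbf{m}\in\mathbb{W}^n$, $k\in\mathbb{W}$, and let $\underline{S}\subseteq V^n$ satisfy $I(\underline{S})=\{0\}$. Let $\{\underline{a}_i\}_{0\le i<l_{\mathbf{m}}}$ be a $\nu_{\mathbf{m}}$-ordering of $\underline{S}$. Then the associated polynomials $\{F_{\mathbf{m},r}\}_{0\le r<l_{\mathbf{m},k}}$ form a $V$-basis of the $V$-module $\mathrm{Int}_{\mathbf{m},k}(\underline{S},V)$. Hence, for $f\in K[\underline{x}]$ of type $(\mathbf{m},k)$, $$f\in\mathrm{Int}_{\mathbf{m},k}(\underline{S},V)\iff f(\underline{a}_r)\in V\ \text{ for all } 0\le r<l_{\mathbf{m},k}.$$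
   Context: $\mathbb{W}$ is the set of non-negative integers; $\underline{x}=(x_1,\dots,x_n)$. $\deg(f)\in\mathbb{W}^n$ is the $n$-tuple of partial degrees of $f$ and $\mathrm{tdeg}(f)$ its total degree; $f$ is of type $(\mathbf{m},k)$ if $\deg(f)=\mathbf{m}$, $\mathrm{tdeg}(f)=k$; order on $\mathbb{W}^n$ is componentwise. $I(\underline{S})=\{f\in K[\underline{x}]:f(\underline{S})=0\}$. $\mathrm{Int}_{\mathbf{m},k}(\underline{S},V)=\{f\in K[\underline{x}]: f(\underline{S})\subseteq V,\ \deg(f)\le\mathbf{m},\ \mathrm{tdeg}(f)\le k\}$ (including $0$). Let $l_{\mathbf{m}}$ be the number of monomials (with coefficient 1) of degree $\le\mathbf{m}$, and $l_{\mathbf{m},k}$ the number of those that moreover have total degree $\le k$. Fix an enumeration $(p_j)_{0\le j<l_{\mathbf{m}}}$ of the monomials of degree $\le\mathbf{m}$ with $p_0=1$ and $\mathrm{tdeg}(p_i)\le\mathrm{tdeg}(p_j)$ for $i<j$. For $r<l_{\mathbf{m}}$ put $\Delta_{\mathbf{m}}(\underline{a}_0,\dots,\underline{a}_r)=\det(p_j(\underline{a}_i))_{0\le i,j\le r}$ (the last entry may also be the variable $\underline{x}$). A sequence $\{\underline{a}_i\}_{0\le i<l_{\mathbf{m}}}$ in $\underline{S}$ is a $\nu_{\mathbf{m}}$-ordering of $\underline{S}$ if for every $1\le r<l_{\mathbf{m}}$, $\nu(\Delta_{\mathbf{m}}(\underline{a}_0,\dots,\underline{a}_r))=\inf_{\underline{a}\in\underline{S}}\nu(\Delta_{\mathbf{m}}(\underline{a}_0,\dots,\underline{a}_{r-1},\underline{a}))$.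 When $I(\underline{S})=\{0\}$ these determinants are nonzero, and one sets $F_{\mathbf{m},0}=1$ and $F_{\mathbf{m},r}(\underline{x})=\dfrac{\Delta_{\mathbf{m}}(\underline{a}_0,\dots,\underline{a}_{r-1},\underline{x})}{\Delta_{\mathbf{m}}(\underline{a}_0,\dots,\underline{a}_r)}$ for $1\le r<l_{\mathbf{m}}$. *)

theory Defs
  imports
    "HOL-Library.Poly_Mapping"
    "HOL-Library.Extended_Real"
    "Jordan_Normal_Form.Determinant"
begin

section \<open>Discrete valuation rings\<close>

text \<open>
  A (normalised) discrete valuation on a field, with value \<open>\<infinity>\<close> at \<open>0\<close>. The values lie in
  \<open>\<int> \<union> {\<infinity>}\<close>; the type \<^typ>\<open>ereal\<close> is used because it is a complete lattice, so that
  infima of sets of values make sense.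
\<close>

definition discrete_valuation :: "('k::field \<Rightarrow> ereal) \<Rightarrow> bool" where
  "discrete_valuation \<nu> \<longleftrightarrow>
     (\<forall>x. \<nu> x = \<infinity> \<longleftrightarrow> x = 0) \<and>
     \<nu> ` (UNIV - {0}) = range (\<lambda>z::int. ereal (of_int z)) \<and>
     (\<forall>x y. \<nu> (x * y) = \<nu> x + \<nu> y) \<and>
     (\<forall>x y. \<nu> (x + y) \<ge> min (\<nu> x) (\<nu> y))"

text \<open>
  \<open>V\<close> is a discrete valuation ring with valuation \<open>\<nu>\<close> and field of fractions the whole
  type \<open>'k\<close>; see \<open>dvr_subring\<close> and \<open>dvr_fraction_field\<close> below.
\<close>

definition dvr :: "'k::field set \<Rightarrow> ('k \<Rightarrow> ereal) \<Rightarrow> bool" where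
  "dvr V \<nu> \<longleftrightarrow> discrete_valuation \<nu> \<and> V = {x. 0 \<le> \<nu> x}"

lemma discrete_valuationD:
  assumes "discrete_valuation \<nu>"
  shows "\<nu> 0 = \<infinity>"
    and "x \<noteq> 0 \<Longrightarrow> \<exists>z::int. \<nu> x = ereal (of_int z)"
    and "\<nu> (x * y) = \<nu> x + \<nu> y"
    and "min (\<nu> x) (\<nu> y) \<le> \<nu> (x + y)"
proof -
  note d = assms[unfolded discrete_valuation_def]
  from d show "\<nu> 0 = \<infinity>" by (elim conjE allE[of _ 0]) simp
  from d have image: "\<nu> ` (UNIV - {0}) = range (\<lambda>z::int. ereal (of_int z))" by (elim conjE)
  show "\<exists>z::int. \<nu> x = ereal (of_int z)" if "x \<noteq> 0"
  proof -
    have "\<nu> x \<in> \<nu> ` (UNIV - {0})" using that by (intro imageI) simp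
    then have "\<nu> x \<in> range (\<lambda>z::int. ereal (of_int z))" by (simp only: image)
    then show ?thesis by (rule rangeE) (rule exI)
  qed
  from d show "\<nu> (x * y) = \<nu> x + \<nu> y" by (elim conjE) (erule spec2)
  from d show "min (\<nu> x) (\<nu> y) \<le> \<nu> (x + y)" by (elim conjE) (erule spec2)
qed

lemma discrete_valuation_one:
  assumes "discrete_valuation \<nu>"
  shows "\<nu> 1 = 0"
proof -
  obtain z :: int where z: "\<nu> 1 = ereal (of_int z)"
    using discrete_valuationD(2)[OF assms, of 1] by auto
  have "\<nu> 1 = \<nu> 1 + \<nu> 1"
    using discrete_valuationD(3)[OF assms, of 1 1] by (simp only: mult_1_left)
  with z show ?thesis by simp
qed

lemma discrete_valuation_minus_one:
  assumes "discrete_valuation \<nu>"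
  shows "\<nu> (- 1) = 0"
proof -
  obtain z :: int where z: "\<nu> (- 1) = ereal (of_int z)"
    using discrete_valuationD(2)[OF assms, of "- 1"] by auto
  have "\<nu> 1 = \<nu> (- 1) + \<nu> (- 1)"
    using discrete_valuationD(3)[OF assms, of "- 1" "- 1"] by simp
  with z discrete_valuation_one[OF assms] show ?thesis by (simp add: zero_ereal_def)
qed

lemma dvr_subring:
  assumes "dvr V \<nu>"
  shows "0 \<in> V" "1 \<in> V"
    and "x \<in> V \<Longrightarrow> - x \<in> V"
    and "x \<in> V \<Longrightarrow> y \<in> V \<Longrightarrow> x + y \<in> V"
    and "x \<in> V \<Longrightarrow> y \<in> V \<Longrightarrow> x * y \<in> V"
proof -
  have d: "discrete_valuation \<nu>" and V: "\<And>x. x \<in> V \<longleftrightarrow> 0 \<le> \<nu> x"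
    using assms by (simp_all add: dvr_def)
  show "0 \<in> V" "1 \<in> V"
    by (simp_all add: V discrete_valuationD(1)[OF d] discrete_valuation_one[OF d])
  show "- x \<in> V" if "x \<in> V"
    using that discrete_valuationD(3)[OF d, of "- 1" x]
    by (simp add: V discrete_valuation_minus_one[OF d])
  show "x + y \<in> V" if "x \<in> V" "y \<in> V"
  proof -
    have "0 \<le> min (\<nu> x) (\<nu> y)" using that by (simp add: V)
    also have "\<dots> \<le> \<nu> (x + y)" by (rule discrete_valuationD(4)[OF d])
    finally show ?thesis by (simp add: V)
  qed
  show "x * y \<in> V" if "x \<in> V" "y \<in> V"
    using that by (simp add: V discrete_valuationD(3)[OF d])
qed

lemma dvr_fraction_field:
  assumes "dvr V \<nu>"
  obtains a b where "a \<in> V" "b \<in> V" "b \<noteq> 0" "x = a / b"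
proof (cases "x \<in> V")
  case True
  then show ?thesis using that[of x 1] dvr_subring(2)[OF assms] by simp
next
  case False
  have d: "discrete_valuation \<nu>" and V: "\<And>x. x \<in> V \<longleftrightarrow> 0 \<le> \<nu> x"
    using assms by (simp_all add: dvr_def)
  have x: "x \<noteq> 0" using False dvr_subring(1)[OF assms] by auto
  obtain y z :: int where yz: "\<nu> x = ereal (of_int y)" "\<nu> (inverse x) = ereal (of_int z)"
    using x discrete_valuationD(2)[OF d, of x] discrete_valuationD(2)[OF d, of "inverse x"]
    by auto
  have "\<nu> x + \<nu> (inverse x) = 0"
    using x discrete_valuationD(3)[OF d, of x "inverse x"] discrete_valuation_one[OF d] by simp
  with False have "inverse x \<in> V"
    by (simp add: V yz)
  then show ?thesis
    using that[of 1 "inverse x"] x dvr_subring(2)[OF assms] by (simp add: divide_inverse)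
qed


section \<open>Polynomials in several variables\<close>

text \<open>
  The variables are indexed by the finite (nonempty) type \<open>'n\<close>; a polynomial maps exponent
  vectors to coefficients. Multi-degrees in \<open>\<nat>\<^sup>n\<close> have type \<^typ>\<open>'n \<Rightarrow> nat\<close>, whose
  order is componentwise.
\<close>

type_synonym ('n, 'k) mpoly = "('n \<Rightarrow>\<^sub>0 nat) \<Rightarrow>\<^sub>0 'k"

definition Const :: "'k \<Rightarrow> ('n, 'k::zero) mpoly" where
  "Const c = Poly_Mapping.single 0 c"

definition peval :: "('n::finite, 'k::comm_semiring_1) mpoly \<Rightarrow> ('n \<Rightarrow> 'k) \<Rightarrow> 'k" where
  "peval f a =
     (\<Sum>e\<in>Poly_Mapping.keys f.
        Poly_Mapping.lookup f e * (\<Prod>i\<in>UNIV. a i ^ Poly_Mapping.lookup e i))"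

text \<open>The zero polynomial gets all degrees \<open>0\<close>.\<close>

definition mdeg :: "('n, 'k::zero) mpoly \<Rightarrow> 'n \<Rightarrow> nat" where
  "mdeg f = (\<lambda>i. Max (insert 0 ((\<lambda>e. Poly_Mapping.lookup e i) ` Poly_Mapping.keys f)))"

definition tdeg :: "('n::finite, 'k::zero) mpoly \<Rightarrow> nat" where
  "tdeg f = Max (insert 0 ((\<lambda>e. \<Sum>i\<in>UNIV. Poly_Mapping.lookup e i) ` Poly_Mapping.keys f))"

definition vanishing_ideal ::
    "('n::finite \<Rightarrow> 'k::comm_semiring_1) set \<Rightarrow> ('n, 'k) mpoly set" where
  "vanishing_ideal S = {f. \<forall>a\<in>S. peval f a = 0}"

definition Int_mk ::
    "('n::finite \<Rightarrow> nat) \<Rightarrow> nat \<Rightarrow> ('n \<Rightarrow> 'k::comm_semiring_1) set \<Rightarrow> 'k set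
      \<Rightarrow> ('n, 'k) mpoly set" where
  "Int_mk m k S V = {f. peval f ` S \<subseteq> V \<and> mdeg f \<le> m \<and> tdeg f \<le> k}"

definition monomials :: "('n::finite \<Rightarrow> nat) \<Rightarrow> ('n, 'k::comm_semiring_1) mpoly set" where
  "monomials m = {p. (\<exists>e. p = Poly_Mapping.single e 1) \<and> mdeg p \<le> m}"

text \<open>
  The numbers \<open>l\<^sub>m\<close> and \<open>l\<^sub>m\<^sub>,\<^sub>k\<close>. They do not depend on the coefficient field, which
  is passed as an \<open>itself\<close> argument.
\<close>

definition lm :: "'k::comm_semiring_1 itself \<Rightarrow> ('n::finite \<Rightarrow> nat) \<Rightarrow> nat" where
  "lm _ m = card (monomials m :: ('n, 'k) mpoly set)"

definition lmk :: "'k::comm_semiring_1 itself \<Rightarrow> ('n::finite \<Rightarrow> nat) \<Rightarrow> nat \<Rightarrow> nat" where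
  "lmk _ m k = card {p :: ('n, 'k) mpoly. p \<in> monomials m \<and> tdeg p \<le> k}"

definition monomial_enumeration ::
    "('n::finite \<Rightarrow> nat) \<Rightarrow> (nat \<Rightarrow> ('n, 'k::comm_semiring_1) mpoly) \<Rightarrow> bool" where
  "monomial_enumeration m p \<longleftrightarrow>
     bij_betw p {..<lm TYPE('k) m} (monomials m) \<and>
     p 0 = 1 \<and>
     (\<forall>i j. i < j \<and> j < lm TYPE('k) m \<longrightarrow> tdeg (p i) \<le> tdeg (p j))"


section \<open>Valuative orderings and the associated polynomials\<close>

definition \<Delta> ::
    "(nat \<Rightarrow> ('n::finite, 'k::comm_ring_1) mpoly) \<Rightarrow> (nat \<Rightarrow> 'n \<Rightarrow> 'k) \<Rightarrow> nat \<Rightarrow> 'k" where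
  "\<Delta> p a r = det (mat (r + 1) (r + 1) (\<lambda>(i, j). peval (p j) (a i)))"

text \<open>
  \<open>\<Delta>(a\<^sub>0, \<dots>, a\<^sub>r\<^sub>-\<^sub>1, x)\<close> with the variable \<open>x\<close> as last entry: the last row consists
  of the monomials themselves.
\<close>

definition \<Delta>_var ::
    "(nat \<Rightarrow> ('n::finite, 'k::comm_ring_1) mpoly) \<Rightarrow> (nat \<Rightarrow> 'n \<Rightarrow> 'k) \<Rightarrow> nat
      \<Rightarrow> ('n, 'k) mpoly" where
  "\<Delta>_var p a r =
     det (mat (r + 1) (r + 1) (\<lambda>(i, j). if i < r then Const (peval (p j) (a i)) else p j))"

text \<open>
  A sequence \<open>(a\<^sub>i)\<close>, \<open>0 \<le> i < l\<^sub>m\<close>, is a function on \<^typ>\<open>nat\<close> whose values at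
  other indices are irrelevant.
\<close>

definition nu_ordering ::
    "('k::field \<Rightarrow> ereal) \<Rightarrow> ('n::finite \<Rightarrow> nat) \<Rightarrow> (nat \<Rightarrow> ('n, 'k) mpoly)
      \<Rightarrow> ('n \<Rightarrow> 'k) set \<Rightarrow> (nat \<Rightarrow> 'n \<Rightarrow> 'k) \<Rightarrow> bool" where
  "nu_ordering \<nu> m p S a \<longleftrightarrow>
     (\<forall>i < lm TYPE('k) m. a i \<in> S) \<and>
     (\<forall>r. 1 \<le> r \<and> r < lm TYPE('k) m \<longrightarrow>
        \<nu> (\<Delta> p a r) = (INF b\<in>S. \<nu> (\<Delta> p (a(r := b)) r)))"

definition F_poly ::
    "(nat \<Rightarrow> ('n::finite, 'k::field) mpoly) \<Rightarrow> (nat \<Rightarrow> 'n \<Rightarrow> 'k) \<Rightarrow> nat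
      \<Rightarrow> ('n, 'k) mpoly" where
  "F_poly p a r = (if r = 0 then 1 else Const (1 / \<Delta> p a r) * \<Delta>_var p a r)"

text \<open>
  The family \<open>(F\<^sub>r)\<close>, \<open>0 \<le> r < l\<close>, is a \<open>V\<close>-basis of \<open>M\<close>: its \<open>V\<close>-linear span is \<open>M\<close>
  and it is \<open>V\<close>-linearly independent.
\<close>

definition is_V_basis ::
    "'k::comm_ring_1 set \<Rightarrow> (nat \<Rightarrow> ('n, 'k) mpoly) \<Rightarrow> nat \<Rightarrow> ('n, 'k) mpoly set \<Rightarrow> bool" where
  "is_V_basis V F l M \<longleftrightarrow>
     M = {\<Sum>r<l. Const (c r) * F r | c. \<forall>r<l. c r \<in> V} \<and>
     (\<forall>c. (\<forall>r<l. c r \<in> V) \<and> (\<Sum>r<l. Const (c r) * F r) = 0 \<longrightarrow> (\<forall>r<l. c r = 0))"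

end

theory Submission
  imports Defs
begin

text \<open>
  Expanding along the last row, \<open>F\<^sub>r\<close> is a combination of \<open>p\<^sub>0, \<dots>, p\<^sub>r\<close> whose leading
  coefficient \<open>\<Delta>(a\<^sub>0, \<dots>, a\<^sub>r\<^sub>-\<^sub>1) / \<Delta>(a\<^sub>0, \<dots>, a\<^sub>r)\<close> is nonzero, so the \<open>F\<^sub>r\<close> with
  \<open>r < l\<^sub>m\<^sub>,\<^sub>k\<close> span over \<open>K\<close> the polynomials of degree \<open>\<le> (m, k)\<close>. The ordering
  property says exactly that \<open>F\<^sub>r\<close> maps \<open>S\<close> into \<open>V\<close>. As \<open>F\<^sub>r(a\<^sub>i) = 0\<close> for \<open>i < r\<close>
  and \<open>F\<^sub>r(a\<^sub>r) = 1\<close>, the coordinates of \<open>f\<close> are recovered from the values \<open>f(a\<^sub>r)\<close> by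
  a unitriangular system over \<open>V\<close>.
\<close>

section \<open>Polynomials and their degrees\<close>

lemma lookup_Const_mult:
  "Poly_Mapping.lookup (Const c * f) e = c * Poly_Mapping.lookup f e"
  unfolding Const_def
  by (subst mult_map_scale_conv_mult[symmetric]) (simp add: Poly_Mapping.map.rep_eq when_def)

lemma keys_Const_mult:
  "Poly_Mapping.keys (Const c * f) \<subseteq> Poly_Mapping.keys f"
  by (auto simp: in_keys_iff lookup_Const_mult)

text \<open>This lets \<open>Const\<close> pass through the determinants in
  \<open>\<Delta>_var_expansion\<close> and the differences in \<open>F_poly_span\<close>.\<close>

lemma comm_ring_hom_Const:
  "comm_ring_hom (Const :: 'k::comm_ring_1 \<Rightarrow> ('n, 'k) mpoly)"
  by unfold_locales (simp_all add: Const_def single_add mult_single)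

text \<open>The added exponents have coefficient zero; several polynomials can thus be evaluated
  over one index set.\<close>

lemma peval_superset:
  assumes "finite A" "Poly_Mapping.keys f \<subseteq> A"
  shows "peval f a =
    (\<Sum>e\<in>A. Poly_Mapping.lookup f e * (\<Prod>i\<in>UNIV. a i ^ Poly_Mapping.lookup e i))"
  unfolding peval_def using assms by (intro sum.mono_neutral_left) (auto simp: in_keys_iff)

lemma peval_zero [simp]: "peval 0 a = 0"
  by (simp add: peval_def)

lemma peval_one [simp]: "peval 1 a = 1"
  by (simp add: peval_def flip: single_one)

lemma peval_add: "peval (f + g) a = peval f a + peval g a"
proof -
  let ?A = "Poly_Mapping.keys f \<union> Poly_Mapping.keys g"
  have "finite ?A" by simp
  then show ?thesis
    by (simp add: peval_superset[of ?A] Poly_Mapping.keys_add lookup_add sum.distrib distrib_right)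
qed

lemma peval_sum: "peval (\<Sum>i\<in>I. f i) a = (\<Sum>i\<in>I. peval (f i) a)"
  by (induction I rule: infinite_finite_induct) (simp_all add: peval_add)

lemma peval_Const_mult: "peval (Const c * f) a = c * peval f a"
  by (simp add: peval_superset[OF finite_keys keys_Const_mult] lookup_Const_mult
      peval_def[of f] sum_distrib_left mult.assoc)

lemma mdeg_le_iff:
  "mdeg f \<le> m \<longleftrightarrow> (\<forall>e\<in>Poly_Mapping.keys f. \<forall>i. Poly_Mapping.lookup e i \<le> m i)"
  by (auto simp: mdeg_def le_fun_def)

lemma tdeg_le_iff:
  "tdeg f \<le> k \<longleftrightarrow> (\<forall>e\<in>Poly_Mapping.keys f. (\<Sum>i\<in>UNIV. Poly_Mapping.lookup e i) \<le> k)"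
  by (auto simp: tdeg_def)

section \<open>Determinants with a variable last row\<close>

text \<open>The cofactor deletes row \<open>r\<close>, so the value depends on \<open>a 0\<close>,
  ..., \<open>a (r - 1)\<close> only; the same coefficients serve for a point and for the variable
  in the last row.\<close>

definition \<Delta>_coeff ::
    "(nat \<Rightarrow> ('n::finite, 'k::comm_ring_1) mpoly) \<Rightarrow> (nat \<Rightarrow> 'n \<Rightarrow> 'k) \<Rightarrow> nat \<Rightarrow> nat \<Rightarrow> 'k"
  where "\<Delta>_coeff p a r j = cofactor (mat (r + 1) (r + 1) (\<lambda>(i, j). peval (p j) (a i))) r j"

lemma cofactor_cong_rows:
  assumes "\<And>i j. i < r \<Longrightarrow> j \<le> r \<Longrightarrow> f (i, j) = g (i, j)"
  shows "cofactor (mat (r + 1) (r + 1) f) r j = cofactor (mat (r + 1) (r + 1) g) r j"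
proof -
  have "mat_delete (mat (r + 1) (r + 1) f) r j = mat_delete (mat (r + 1) (r + 1) g) r j"
    using assms by (intro eq_matI) (auto simp: mat_delete_def)
  then show ?thesis by (simp add: cofactor_def)
qed

lemma \<Delta>_upd_expansion:
  "\<Delta> p (a(r := b)) r = (\<Sum>j\<le>r. \<Delta>_coeff p a r j * peval (p j) b)"
proof -
  let ?A = "mat (r + 1) (r + 1) (\<lambda>(i, j). peval (p j) ((a(r := b)) i))"
  have "\<Delta> p (a(r := b)) r = (\<Sum>j<r + 1. ?A $$ (r, j) * cofactor ?A r j)"
    unfolding \<Delta>_def by (rule laplace_expansion_row) auto
  also have "\<dots> = (\<Sum>j\<le>r. \<Delta>_coeff p a r j * peval (p j) b)"
  proof (rule sum.cong)
    fix j assume "j \<in> {..r}"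
    moreover have "cofactor ?A r j = \<Delta>_coeff p a r j"
      unfolding \<Delta>_coeff_def by (rule cofactor_cong_rows) auto
    ultimately show "?A $$ (r, j) * cofactor ?A r j = \<Delta>_coeff p a r j * peval (p j) b"
      by (simp add: mult.commute)
  qed auto
  finally show ?thesis .
qed

lemma \<Delta>_var_expansion:
  "\<Delta>_var p a r = (\<Sum>j\<le>r. Const (\<Delta>_coeff p a r j) * p j)"
proof -
  interpret C: comm_ring_hom "Const :: 'b \<Rightarrow> ('a, 'b) mpoly" by (rule comm_ring_hom_Const)
  let ?A = "mat (r + 1) (r + 1) (\<lambda>(i, j). if i < r then Const (peval (p j) (a i)) else p j)"
  let ?B = "mat (r + 1) (r + 1) (\<lambda>(i, j). peval (p j) (a i))"
  have "\<Delta>_var p a r = (\<Sum>j<r + 1. ?A $$ (r, j) * cofactor ?A r j)"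
    unfolding \<Delta>_var_def by (rule laplace_expansion_row) auto
  also have "\<dots> = (\<Sum>j\<le>r. Const (\<Delta>_coeff p a r j) * p j)"
  proof (rule sum.cong)
    fix j assume j: "j \<in> {..r}"
    \<comment> \<open>Without its last row the polynomial matrix has only constant entries, so its
      cofactors are constants too.\<close>
    have "mat_delete ?A r j = map_mat Const (mat_delete ?B r j)"
      using j by (intro eq_matI) (auto simp: mat_delete_def)
    then have "cofactor ?A r j = Const (\<Delta>_coeff p a r j)"
      by (simp add: cofactor_def \<Delta>_coeff_def C.hom_mult C.hom_power C.hom_uminus)
    then show "?A $$ (r, j) * cofactor ?A r j = Const (\<Delta>_coeff p a r j) * p j"
      using j by (simp add: mult.commute)
  qed auto
  finally show ?thesis .
qed

text \<open>Both sides have the same expansion along the last row, so linearity of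
  \<open>peval\<close> suffices.\<close>

lemma peval_\<Delta>_var: "peval (\<Delta>_var p a r) b = \<Delta> p (a(r := b)) r"
  by (simp add: \<Delta>_upd_expansion \<Delta>_var_expansion peval_sum peval_Const_mult)

text \<open>Deleting the last row and column leaves the previous matrix, and the sign exponent is
  even. This is the leading coefficient on which the triangularity arguments rest.\<close>

lemma \<Delta>_coeff_last: "\<Delta>_coeff p a (Suc r) (Suc r) = \<Delta> p a r"
proof -
  have "mat_delete (mat (Suc r + 1) (Suc r + 1) (\<lambda>(i, j). peval (p j) (a i))) (Suc r) (Suc r)
      = mat (r + 1) (r + 1) (\<lambda>(i, j). peval (p j) (a i))"
    by (intro eq_matI) (auto simp: mat_delete_def)
  then show ?thesis
    by (simp add: \<Delta>_coeff_def cofactor_def \<Delta>_def flip: power_mult_distrib mult_2)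
qed

lemma \<Delta>_upd_repeated:
  assumes "i < r"
  shows "\<Delta> p (a(r := a i)) r = 0"
  unfolding \<Delta>_def
  by (rule det_identical_rows[where i = i and j = r and n = "r + 1"]) (use assms in auto)

lemma \<Delta>_0:
  assumes "p 0 = 1"
  shows "\<Delta> p a 0 = 1"
  using assms by (simp add: \<Delta>_def det_single)

section \<open>Enumerations of the monomials\<close>

text \<open>Turns an enumeration of monomials as polynomials into one of exponent vectors, at which
  coefficients can be looked up.\<close>

definition expo :: "(nat \<Rightarrow> ('n, 'k::zero_neq_one) mpoly) \<Rightarrow> nat \<Rightarrow> 'n \<Rightarrow>\<^sub>0 nat" where
  "expo p j = (SOME e. p j = Poly_Mapping.single e 1)"

context
  fixes m :: "'n::finite \<Rightarrow> nat" and p :: "nat \<Rightarrow> ('n, 'k::field) mpoly"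
  assumes enum: "monomial_enumeration m p"
begin

lemma enum_bij: "bij_betw p {..<lm TYPE('k) m} (monomials m)"
  using enum by (simp add: monomial_enumeration_def)

lemma single_expo:
  assumes "j < lm TYPE('k) m"
  shows "p j = Poly_Mapping.single (expo p j) 1"
proof -
  have "p j \<in> monomials m" using enum_bij assms by (auto simp: bij_betw_def)
  then have "\<exists>e. p j = Poly_Mapping.single e 1" by (auto simp: monomials_def)
  then show ?thesis unfolding expo_def by (rule someI_ex)
qed

lemma inj_expo: "inj_on (expo p) {..<lm TYPE('k) m}"
proof (rule inj_onI)
  fix i j assume "i \<in> {..<lm TYPE('k) m}" "j \<in> {..<lm TYPE('k) m}" "expo p i = expo p j"
  moreover from this have "p i = p j" by (simp add: single_expo)
  ultimately show "i = j" using enum_bij by (auto simp: bij_betw_def inj_on_def)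
qed

lemma lm_pos: "0 < lm TYPE('k) m"
proof -
  have "(1 :: ('n, 'k) mpoly) \<in> monomials m"
    by (auto simp: monomials_def mdeg_le_iff simp flip: single_one)
  then have "{..<lm TYPE('k) m} \<noteq> {}" using enum_bij by (auto simp: bij_betw_def)
  then show ?thesis by (auto simp: lessThan_empty_iff)
qed

text \<open>The enumeration is sorted by total degree, so these indices form a finite downward
  closed set of naturals; counting its elements gives its length.\<close>

lemma initial_segment:
  "{j. j < lm TYPE('k) m \<and> tdeg (p j) \<le> k} = {..<lmk TYPE('k) m k}"
proof -
  define J where "J = {j. j < lm TYPE('k) m \<and> tdeg (p j) \<le> k}"
  have "p ` J = {q \<in> monomials m. tdeg q \<le> k}"
    using enum_bij by (auto simp: bij_betw_def J_def)
  moreover have "card (p ` J) = card J"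
    using enum_bij by (intro card_image) (auto simp: bij_betw_def inj_on_def J_def)
  ultimately have card: "card J = lmk TYPE('k) m k"
    by (simp add: lmk_def)
  have down: "i \<in> J" if "j \<in> J" "i \<le> j" for i j
  proof (cases "i = j")
    case False
    then have "tdeg (p i) \<le> tdeg (p j)"
      using enum that unfolding monomial_enumeration_def J_def by simp
    then show ?thesis using that by (simp add: J_def)
  qed (use that in simp)
  have fin: "finite J" by (simp add: J_def)
  have "\<exists>n. J = {..<n}"
  proof (cases "J = {}")
    case True
    then show ?thesis by (intro exI[of _ 0]) simp
  next
    case False
    have "x \<in> J \<longleftrightarrow> x \<le> Max J" for x
      using down[OF Max_in[OF fin False], of x] Max_ge[OF fin, of x] by blast
    then have "J = {..<Suc (Max J)}"
      unfolding lessThan_Suc_atMost by blast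
    then show ?thesis ..
  qed
  then obtain n where "J = {..<n}" ..
  then show ?thesis using card by (simp add: J_def)
qed

lemma lmk_le_lm: "lmk TYPE('k) m k \<le> lm TYPE('k) m"
proof -
  have "{..<lmk TYPE('k) m k} \<subseteq> {..<lm TYPE('k) m}"
    unfolding initial_segment[symmetric] by auto
  then show ?thesis by simp
qed

text \<open>Turns the degree bounds into a condition on the support, after which only linear algebra
  in the \<open>p j\<close> remains. The zero polynomial is covered by its empty support.\<close>

lemma degree_bound_iff:
  fixes f :: "('n, 'k) mpoly"
  shows "mdeg f \<le> m \<and> tdeg f \<le> k \<longleftrightarrow> Poly_Mapping.keys f \<subseteq> expo p ` {..<lmk TYPE('k) m k}"
proof -
  have "e \<in> expo p ` {..<lmk TYPE('k) m k} \<longleftrightarrow>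
      (\<forall>i. Poly_Mapping.lookup e i \<le> m i) \<and> (\<Sum>i\<in>UNIV. Poly_Mapping.lookup e i) \<le> k" for e
  proof
    assume "e \<in> expo p ` {..<lmk TYPE('k) m k}"
    then obtain j where j: "j < lm TYPE('k) m" "tdeg (p j) \<le> k" "e = expo p j"
      unfolding initial_segment[symmetric] by auto
    moreover have "p j \<in> monomials m" using enum_bij j by (auto simp: bij_betw_def)
    ultimately show "(\<forall>i. Poly_Mapping.lookup e i \<le> m i) \<and> (\<Sum>i\<in>UNIV. Poly_Mapping.lookup e i) \<le> k"
      using single_expo[OF j(1)] by (auto simp: monomials_def mdeg_le_iff tdeg_le_iff)
  next
    assume e: "(\<forall>i. Poly_Mapping.lookup e i \<le> m i) \<and> (\<Sum>i\<in>UNIV. Poly_Mapping.lookup e i) \<le> k"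
    let ?q = "Poly_Mapping.single e 1 :: ('n, 'k) mpoly"
    have "?q \<in> monomials m" using e by (auto simp: monomials_def mdeg_le_iff)
    then obtain j where j: "j < lm TYPE('k) m" "p j = ?q"
      using enum_bij by (metis bij_betw_def imageE lessThan_iff)
    then have "expo p j = e"
      using single_expo[OF j(1)] by (metis keys_single singleton_inject zero_neq_one)
    moreover have "tdeg (p j) \<le> k" using e j by (simp add: tdeg_le_iff)
    ultimately show "e \<in> expo p ` {..<lmk TYPE('k) m k}"
      unfolding initial_segment[symmetric] using j by auto
  qed
  then show ?thesis unfolding mdeg_le_iff tdeg_le_iff subset_iff by blast
qed

section \<open>Coefficients and supports of linear combinations of monomials\<close>

lemma lookup_combination:
  assumes "l \<le> lm TYPE('k) m" "i < l"
  shows "Poly_Mapping.lookup (\<Sum>j<l. Const (c j) * p j) (expo p i) = c i"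
proof -
  have "Poly_Mapping.lookup (Const (c j) * p j) (expo p i) = (if j = i then c j else 0)"
    if "j < l" for j
    using that assms inj_expo
    by (auto simp: lookup_Const_mult single_expo lookup_single when_def inj_on_def)
  then show ?thesis using assms by (simp add: lookup_sum)
qed

lemma keys_combination:
  assumes "l \<le> lm TYPE('k) m"
  shows "Poly_Mapping.keys (\<Sum>j<l. Const (c j) * p j) \<subseteq> expo p ` {..<l}"
proof -
  have "Poly_Mapping.keys (Const (c j) * p j) \<subseteq> {expo p j}" if "j < l" for j
    using keys_Const_mult[of "c j" "p j"] single_expo[of j] that assms by auto
  then show ?thesis
    using Poly_Mapping.keys_sum[of "\<lambda>j. Const (c j) * p j" "{..<l}"] by fastforce
qed

lemma combination_of_keys:
  fixes f :: "('n, 'k) mpoly"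
  assumes "l \<le> lm TYPE('k) m" "Poly_Mapping.keys f \<subseteq> expo p ` {..<l}"
  shows "f = (\<Sum>j<l. Const (Poly_Mapping.lookup f (expo p j)) * p j)" (is "f = ?g")
proof (rule poly_mapping_eqI)
  fix e
  show "Poly_Mapping.lookup f e = Poly_Mapping.lookup ?g e"
  proof (cases "e \<in> expo p ` {..<l}")
    case True
    then show ?thesis using lookup_combination[OF assms(1)] by auto
  next
    case False
    then have "e \<notin> Poly_Mapping.keys f" "e \<notin> Poly_Mapping.keys ?g"
      using assms(2)
        keys_combination[OF assms(1), of "\<lambda>j. Poly_Mapping.lookup f (expo p j)"] by blast+
    then show ?thesis by (simp add: in_keys_iff)
  qed
qed

end

section \<open>The associated polynomials\<close>

text \<open>Forward substitution. The set \<open>W\<close> is kept general: \<open>W = V\<close>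
  yields integrality of coordinates, \<open>W = {0}\<close> their uniqueness.\<close>

lemma unitriangular_solution_mem:
  fixes G :: "nat \<Rightarrow> nat \<Rightarrow> 'k::comm_ring_1"
  assumes diag: "\<And>r. r < l \<Longrightarrow> G r r = 1"
    and upper: "\<And>i r. i < r \<Longrightarrow> r < l \<Longrightarrow> G r i = 0"
    and lower: "\<And>i r. i < l \<Longrightarrow> r < i \<Longrightarrow> G r i \<in> V"
    and W: "0 \<in> W" "\<And>x y. x \<in> W \<Longrightarrow> y \<in> W \<Longrightarrow> x + y \<in> W" "\<And>x. x \<in> W \<Longrightarrow> - x \<in> W"
      "\<And>x v. x \<in> W \<Longrightarrow> v \<in> V \<Longrightarrow> x * v \<in> W"
    and rhs: "\<And>i. i < l \<Longrightarrow> (\<Sum>r<l. c r * G r i) \<in> W"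
    and "i < l"
  shows "c i \<in> W"
  using \<open>i < l\<close>
proof (induction i rule: less_induct)
  case (less i)
  have W_sum: "(\<Sum>r\<in>A. g r) \<in> W" if "\<And>r. r \<in> A \<Longrightarrow> g r \<in> W" for A :: "nat set" and g
    using that by (induction A rule: infinite_finite_induct) (auto intro: W)
  have "(\<Sum>r<l. c r * G r i) = (\<Sum>r<Suc i. c r * G r i)"
    using less.prems upper by (intro sum.mono_neutral_right) auto
  also have "\<dots> = (\<Sum>r<i. c r * G r i) + c i"
    using less.prems diag by simp
  finally have "c i = (\<Sum>r<l. c r * G r i) + - (\<Sum>r<i. c r * G r i)" by simp
  also have "\<dots> \<in> W"
    using less by (intro W W_sum rhs lower) auto
  finally show ?case .
qed

context
  fixes V :: "'k::field set" and \<nu> :: "'k \<Rightarrow> ereal" and m :: "'n::finite \<Rightarrow> nat"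
    and S :: "('n \<Rightarrow> 'k) set" and p :: "nat \<Rightarrow> ('n, 'k) mpoly" and a :: "nat \<Rightarrow> 'n \<Rightarrow> 'k"
  assumes dvr: "dvr V \<nu>"
    and vanish: "vanishing_ideal S = {0}"
    and enum: "monomial_enumeration m p"
    and ordering: "nu_ordering \<nu> m p S a"
begin

section \<open>Consequences of the ordering: nonzero determinants and values of the associated
  polynomials\<close>

lemma p_0: "p 0 = 1"
  using enum by (simp add: monomial_enumeration_def)

lemma dv: "discrete_valuation \<nu>" and V_iff: "x \<in> V \<longleftrightarrow> 0 \<le> \<nu> x"
  using dvr by (auto simp: dvr_def)

lemma ordering_mem: "r < lm TYPE('k) m \<Longrightarrow> a r \<in> S"
  using ordering by (simp add: nu_ordering_def)

lemma ordering_le: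
  assumes "1 \<le> r" "r < lm TYPE('k) m" "b \<in> S"
  shows "\<nu> (\<Delta> p a r) \<le> \<nu> (\<Delta> p (a(r := b)) r)"
  using ordering assms by (auto simp: nu_ordering_def intro: INF_lower)

text \<open>By induction the leading coefficient of \<open>\<Delta>_var p a (Suc r)\<close> is
  nonzero, so this polynomial cannot vanish on all of \<open>S\<close>.\<close>

lemma \<Delta>_nonzero: "r < lm TYPE('k) m \<Longrightarrow> \<Delta> p a r \<noteq> 0"
proof (induction r)
  case 0
  then show ?case using p_0 by (simp add: \<Delta>_0)
next
  case (Suc r)
  have "Poly_Mapping.lookup (\<Delta>_var p a (Suc r)) (expo p (Suc r)) = \<Delta> p a r"
    using lookup_combination[OF enum, of "Suc (Suc r)" "Suc r" "\<Delta>_coeff p a (Suc r)"] Suc.prems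
    unfolding \<Delta>_var_expansion \<Delta>_coeff_last lessThan_Suc_atMost by simp
  then have "\<Delta>_var p a (Suc r) \<noteq> 0" using Suc by auto
  then have "\<Delta>_var p a (Suc r) \<notin> vanishing_ideal S" using vanish by simp
  then obtain b where "b \<in> S" "\<Delta> p (a(Suc r := b)) (Suc r) \<noteq> 0"
    by (auto simp: vanishing_ideal_def peval_\<Delta>_var)
  \<comment> \<open>The value at \<open>b\<close> has finite valuation; by minimality so has the
    determinant at \<open>a\<close>, whereas zero has valuation \<open>\<infinity>\<close>.\<close>
  then show ?case
    using ordering_le[of "Suc r" b] Suc.prems discrete_valuationD(1,2)[OF dv] by fastforce
qed

lemma peval_F_poly:
  assumes "r < lm TYPE('k) m"
  shows "peval (F_poly p a r) b = \<Delta> p (a(r := b)) r / \<Delta> p a r"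
  \<comment> \<open>For \<open>r = 0\<close>, where \<open>F_poly\<close> is set to 1, both
    determinants equal 1.\<close>
  using p_0 by (simp add: F_poly_def peval_Const_mult peval_\<Delta>_var \<Delta>_0)

lemma peval_F_poly_diag: "r < lm TYPE('k) m \<Longrightarrow> peval (F_poly p a r) (a r) = 1"
  by (simp add: peval_F_poly \<Delta>_nonzero)

lemma peval_F_poly_earlier:
  "r < lm TYPE('k) m \<Longrightarrow> i < r \<Longrightarrow> peval (F_poly p a r) (a i) = 0"
  by (simp add: peval_F_poly \<Delta>_upd_repeated)

lemma peval_F_poly_mem:
  assumes "r < lm TYPE('k) m" "b \<in> S"
  shows "peval (F_poly p a r) b \<in> V"
\<comment> \<open>The minimality condition starts at \<open>r = 1\<close>, so index 0 is treated
  apart.\<close>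
proof (cases "r = 0")
  case True
  then show ?thesis using dvr_subring(2)[OF dvr] by (simp add: F_poly_def)
next
  case False
  define q where "q = peval (F_poly p a r) b"
  have "\<Delta> p (a(r := b)) r = \<Delta> p a r * q"
    using assms by (simp add: q_def peval_F_poly \<Delta>_nonzero)
  then have "\<nu> (\<Delta> p a r) \<le> \<nu> (\<Delta> p a r) + \<nu> q"
    using ordering_le[of r b] False assms by (simp add: discrete_valuationD(3)[OF dv])
  \<comment> \<open>Finiteness of this valuation permits cancelling it in
    \<open>ereal\<close>.\<close>
  moreover obtain z :: int where "\<nu> (\<Delta> p a r) = ereal (of_int z)"
    using discrete_valuationD(2)[OF dv \<Delta>_nonzero[OF assms(1)]] by auto
  ultimately have "0 \<le> \<nu> q" by (cases "\<nu> q") auto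
  then show ?thesis by (simp add: V_iff q_def)
qed

section \<open>Triangular change of basis between the monomials and the associated
  polynomials\<close>

lemma F_poly_expansion:
  assumes "r < lm TYPE('k) m"
  obtains d where "d r \<noteq> 0" "F_poly p a r = (\<Sum>j\<le>r. Const (d j) * p j)"
proof (cases r)
  case 0
  then show ?thesis
    using that[of "\<lambda>_. 1"] p_0 by (simp add: F_poly_def Const_def)
next
  case (Suc s)
  define d where "d j = 1 / \<Delta> p a r * \<Delta>_coeff p a r j" for j
  \<comment> \<open>The leading coefficient is the quotient of \<open>\<Delta> p a s\<close> by
    \<open>\<Delta> p a r\<close>, both nonzero.\<close>
  have "d r \<noteq> 0"
    using \<Delta>_nonzero[of r] \<Delta>_nonzero[of s] assms Suc by (simp add: d_def \<Delta>_coeff_last)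
  moreover have "F_poly p a r = (\<Sum>j\<le>r. Const (d j) * p j)"
    using Suc by (simp add: F_poly_def \<Delta>_var_expansion d_def sum_distrib_left Const_def mult_single
        mult.assoc[symmetric] del: sum.atMost_Suc)
  ultimately show ?thesis by (rule that)
qed

lemma keys_F_poly:
  assumes "r < l" "l \<le> lm TYPE('k) m"
  shows "Poly_Mapping.keys (F_poly p a r) \<subseteq> expo p ` {..<l}"
proof -
  obtain d where "F_poly p a r = (\<Sum>j\<le>r. Const (d j) * p j)"
    using F_poly_expansion[of r] assms by auto
  then have "Poly_Mapping.keys (F_poly p a r) \<subseteq> expo p ` {..<Suc r}"
    using keys_combination[OF enum, of "Suc r" d] assms by (simp add: lessThan_Suc_atMost)
  then show ?thesis using assms(1) by fastforce
qed

lemma F_poly_span: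
  assumes "l \<le> lm TYPE('k) m"
  shows "\<exists>c. (\<Sum>j<l. Const (d j) * p j) = (\<Sum>r<l. Const (c r) * F_poly p a r)"
  using assms
proof (induction l arbitrary: d)
  case (Suc l)
  interpret C: comm_ring_hom "Const :: 'k \<Rightarrow> ('n, 'k) mpoly" by (rule comm_ring_hom_Const)
  obtain g where g: "g l \<noteq> 0" "F_poly p a l = (\<Sum>j\<le>l. Const (g j) * p j)"
    using F_poly_expansion[of l] Suc.prems by auto
  \<comment> \<open>Subtracting \<open>t\<close> times \<open>F_poly p a l\<close> cancels the term
    in \<open>p l\<close>; the rest is a shorter combination with changed coefficients, hence the
    induction over arbitrary \<open>d\<close>.\<close>
  define t where "t = d l / g l"
  obtain c where c: "(\<Sum>j<l. Const (d j - t * g j) * p j) = (\<Sum>r<l. Const (c r) * F_poly p a r)"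
    using Suc.IH[of "\<lambda>j. d j - t * g j"] Suc.prems by auto
  have "d l = t * g l" using g(1) by (simp add: t_def)
  then have "(\<Sum>j<Suc l. Const (d j) * p j) =
      (\<Sum>j<l. Const (d j - t * g j) * p j) + Const t * F_poly p a l"
    by (simp add: g(2) C.hom_minus C.hom_mult sum_subtractf sum_distrib_left algebra_simps
        flip: lessThan_Suc_atMost)
  also have "\<dots> = (\<Sum>r<Suc l. Const ((c(l := t)) r) * F_poly p a r)"
    by (simp add: c)
  finally show ?case by blast
qed simp

text \<open>Evaluation at the points \<open>a i\<close> gives a linear system for the coordinates
  with a unitriangular matrix whose entries lie in \<open>V\<close>.\<close>

lemma coordinates_mem:
  assumes l: "l \<le> lm TYPE('k) m"
    and W: "0 \<in> W" "\<And>x y. x \<in> W \<Longrightarrow> y \<in> W \<Longrightarrow> x + y \<in> W" "\<And>x. x \<in> W \<Longrightarrow> - x \<in> W"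
      "\<And>x v. x \<in> W \<Longrightarrow> v \<in> V \<Longrightarrow> x * v \<in> W"
    and vals: "\<And>i. i < l \<Longrightarrow> peval (\<Sum>r<l. Const (c r) * F_poly p a r) (a i) \<in> W"
    and "i < l"
  shows "c i \<in> W"
proof (rule unitriangular_solution_mem[where G = "\<lambda>r i. peval (F_poly p a r) (a i)" and V = V])
  show "(\<Sum>r<l. c r * peval (F_poly p a r) (a i)) \<in> W" if "i < l" for i
    using vals[OF that] by (simp add: peval_sum peval_Const_mult)
  show "peval (F_poly p a r) (a i) \<in> V" if "i < l" "r < i" for i r
    using that l by (intro peval_F_poly_mem ordering_mem) auto
qed (use l \<open>i < l\<close> in \<open>auto intro: W peval_F_poly_diag peval_F_poly_earlier\<close>)

section \<open>Integer-valued polynomials: the basis property and the test on finitely many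
  points\<close>

lemma combination_mem_Int_mk:
  assumes "\<And>r. r < lmk TYPE('k) m k \<Longrightarrow> c r \<in> V"
  shows "(\<Sum>r<lmk TYPE('k) m k. Const (c r) * F_poly p a r) \<in> Int_mk m k S V"
proof -
  let ?l = "lmk TYPE('k) m k"
  let ?f = "\<Sum>r<?l. Const (c r) * F_poly p a r"
  note l = lmk_le_lm[OF enum, of k]
  have "Poly_Mapping.keys ?f \<subseteq> expo p ` {..<?l}"
  proof (rule order_trans[OF Poly_Mapping.keys_sum], rule UN_least)
    fix r assume "r \<in> {..<?l}"
    then show "Poly_Mapping.keys (Const (c r) * F_poly p a r) \<subseteq> expo p ` {..<?l}"
      using keys_F_poly[OF _ l] by (intro order_trans[OF keys_Const_mult]) simp
  qed
  then have "mdeg ?f \<le> m \<and> tdeg ?f \<le> k"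
    by (simp only: degree_bound_iff[OF enum])
  moreover have "peval ?f b \<in> V" if "b \<in> S" for b
  proof -
    have V_sum: "(\<Sum>r\<in>A. g r) \<in> V" if "\<And>r. r \<in> A \<Longrightarrow> g r \<in> V" for A :: "nat set" and g
      using that by (induction A rule: infinite_finite_induct) (auto intro: dvr_subring[OF dvr])
    show ?thesis
      unfolding peval_sum peval_Const_mult using that l
      by (intro V_sum dvr_subring(5)[OF dvr] assms peval_F_poly_mem) auto
  qed
  ultimately show ?thesis by (auto simp: Int_mk_def)
qed

text \<open>Common core of spanning and of the criterion: coordinates exist over the field by the
  change of basis, and the values at the first points of the ordering alone force them into
  \<open>V\<close>.\<close>

lemma integer_valued_combination:
  fixes f :: "('n, 'k) mpoly"
  assumes "mdeg f \<le> m" "tdeg f \<le> k"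
    and "\<And>r. r < lmk TYPE('k) m k \<Longrightarrow> peval f (a r) \<in> V"
  obtains c where "\<And>r. r < lmk TYPE('k) m k \<Longrightarrow> c r \<in> V"
    "f = (\<Sum>r<lmk TYPE('k) m k. Const (c r) * F_poly p a r)"
proof -
  let ?l = "lmk TYPE('k) m k"
  note l = lmk_le_lm[OF enum, of k]
  have "Poly_Mapping.keys f \<subseteq> expo p ` {..<?l}"
    using assms(1,2) degree_bound_iff[OF enum] by blast
  then have f: "f = (\<Sum>j<?l. Const (Poly_Mapping.lookup f (expo p j)) * p j)"
    by (rule combination_of_keys[OF enum l])
  obtain c where "(\<Sum>j<?l. Const (Poly_Mapping.lookup f (expo p j)) * p j) =
      (\<Sum>r<?l. Const (c r) * F_poly p a r)"
    using F_poly_span[OF l, of "\<lambda>j. Poly_Mapping.lookup f (expo p j)"] by blast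
  with f have c: "f = (\<Sum>r<?l. Const (c r) * F_poly p a r)" by (rule trans)
  have "c r \<in> V" if "r < ?l" for r
  proof (rule coordinates_mem[OF l, where W = V])
    show "peval (\<Sum>r<?l. Const (c r) * F_poly p a r) (a i) \<in> V" if "i < ?l" for i
      using assms(3)[OF that] unfolding c .
  qed (use that in \<open>auto intro: dvr_subring[OF dvr]\<close>)
  then show ?thesis using c by (rule that)
qed

lemma F_poly_basis:
  "is_V_basis V (F_poly p a) (lmk TYPE('k) m k) (Int_mk m k S V)"
  unfolding is_V_basis_def
proof (intro conjI allI impI equalityI subsetI)
  fix f assume f: "f \<in> Int_mk m k S V"
  have "peval f (a r) \<in> V" if "r < lmk TYPE('k) m k" for r
    using f ordering_mem[of r] that lmk_le_lm[OF enum, of k] by (auto simp: Int_mk_def)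
  then obtain c where "\<And>r. r < lmk TYPE('k) m k \<Longrightarrow> c r \<in> V"
    "f = (\<Sum>r<lmk TYPE('k) m k. Const (c r) * F_poly p a r)"
    using integer_valued_combination[of f k] f by (auto simp: Int_mk_def)
  then show "f \<in> {\<Sum>r<lmk TYPE('k) m k. Const (c r) * F_poly p a r | c.
      \<forall>r<lmk TYPE('k) m k. c r \<in> V}" by blast
next
  fix f assume "f \<in> {\<Sum>r<lmk TYPE('k) m k. Const (c r) * F_poly p a r | c.
      \<forall>r<lmk TYPE('k) m k. c r \<in> V}"
  then show "f \<in> Int_mk m k S V" using combination_mem_Int_mk by blast
next
  fix c r
  assume "(\<forall>r<lmk TYPE('k) m k. c r \<in> V) \<and>
      (\<Sum>r<lmk TYPE('k) m k. Const (c r) * F_poly p a r) = 0" and "r < lmk TYPE('k) m k"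
  \<comment> \<open>The zero polynomial has only zero values, so the unitriangular system with
    \<open>W = {0}\<close> gives independence.\<close>
  then have "c r \<in> {0}"
    by (intro coordinates_mem[OF lmk_le_lm[OF enum, of k], where W = "{0}" and c = c and i = r])
      simp_all
  then show "c r = 0" by simp
qed

lemma Int_mk_iff:
  assumes "mdeg f \<le> m" "tdeg f \<le> k"
  shows "f \<in> Int_mk m k S V \<longleftrightarrow> (\<forall>r < lmk TYPE('k) m k. peval f (a r) \<in> V)"
proof
  assume "f \<in> Int_mk m k S V"
  then show "\<forall>r < lmk TYPE('k) m k. peval f (a r) \<in> V"
    using ordering_mem lmk_le_lm[OF enum, of k] by (auto simp: Int_mk_def)
next
  assume "\<forall>r < lmk TYPE('k) m k. peval f (a r) \<in> V"
  then show "f \<in> Int_mk m k S V"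
    \<comment> \<open>The values at the \<open>a r\<close> make \<open>f\<close> a combination over
      \<open>V\<close>, and every such combination maps all of \<open>S\<close> into
      \<open>V\<close>.\<close>
    using integer_valued_combination[OF assms] combination_mem_Int_mk by metis
qed

end

theorem proposition3p3:
  fixes V :: "'k::field set"
    and \<nu> :: "'k \<Rightarrow> ereal"
    and m :: "'n::finite \<Rightarrow> nat"
    and k :: nat
    and S :: "('n \<Rightarrow> 'k) set"
    and p :: "nat \<Rightarrow> ('n, 'k) mpoly"
    and a :: "nat \<Rightarrow> 'n \<Rightarrow> 'k"
  assumes "dvr V \<nu>"
    and "\<forall>b\<in>S. \<forall>i. b i \<in> V"
    and "vanishing_ideal S = {0}"
    and "monomial_enumeration m p"
    and "nu_ordering \<nu> m p S a"
  shows "is_V_basis V (F_poly p a) (lmk TYPE('k) m k) (Int_mk m k S V) \<and>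
    (\<forall>f :: ('n, 'k) mpoly. mdeg f = m \<and> tdeg f = k \<longrightarrow>
      (f \<in> Int_mk m k S V \<longleftrightarrow> (\<forall>r < lmk TYPE('k) m k. peval f (a r) \<in> V)))"
proof (intro conjI allI impI)
  show "is_V_basis V (F_poly p a) (lmk TYPE('k) m k) (Int_mk m k S V)"
    using assms(1,3,4,5) by (rule F_poly_basis)
  fix f :: "('n, 'k) mpoly" assume "mdeg f = m \<and> tdeg f = k"
  then show "f \<in> Int_mk m k S V \<longleftrightarrow> (\<forall>r < lmk TYPE('k) m k. peval f (a r) \<in> V)"
    by (intro Int_mk_iff[OF assms(1,3,4,5)]) simp_all
qed

end
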